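(* Let $n\ge1$ be an integer, let $\Psi_0,\dots,\Psi_n$ be infinitely differentiable functions at $0$, and for every $i=0,\dots,n$ let $$c^{(i)}_m=\frac{i!\,\Psi_i^{(m)}(0)}{(m-1)!},\qquad m\in\mathbb{N}.$$ For $k\in\mathbb{N}$ let $$\boldsymbol{\mu}^{(n)}_k=\sum_{b_1+2b_2+\dots+nb_n=n}\ \sum_{m=0}^{k-b_1-\dots-b_n}\frac{k!}{m!\,(m+1)!\,(k-m-b_1-\dots-b_n)!\,b_1!\cdots b_n!}\left.\frac{d^m}{dx^m}\left((\Psi_0'(x))^{k-m-b_1-\dots-b_n}(\Psi_1'(x))^{b_1}\cdots(\Psi_n'(x))^{b_n}\right)\right|_{x=0}.$$ Then, for every $k\in\mathbb{N}$, $$\boldsymbol{\mu}^{(n)}_k=\sum_{\pi=\{V_1,\dots,V_l\}\in \mathrm{NC}(k)}\ \sum_{\lambda_1+\dots+\lambda_l=n}\frac{1}{\lambda_1!\cdots\lambda_l!}\,c^{(\lambda_1)}_{|V_1|}\cdots c^{(\lambda_l)}_{|V_l|}.$$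
   Context: $\mathbb{N}=\{1,2,\dots\}$. The sum over $b_1,\dots,b_n$ is over non-negative integers satisfying the constraint; an inner sum over $m$ with negative upper limit is zero. $\mathrm{NC}(k)$ is the set of non-crossing partitions of $\{1,\dots,k\}$; $V_1,\dots,V_l$ are the blocks of $\pi$ ($l$ depends on $\pi$), $|V|$ is the cardinality of $V$, and the sum over $\lambda_1,\dots,\lambda_l$ is over $l$-tuples of non-negative integers with sum $n$. *)

theory Defs
  imports "HOL-Analysis.Analysis" "HOL-Library.Disjoint_Sets"
begin

text \<open>
  All derivatives of \<open>f\<close> exist at \<open>x\<close>. The existence of the derivative of order \<open>Suc m\<close> at \<open>x\<close>
  presupposes that the one of order \<open>m\<close> exists near \<open>x\<close>, hence the neighbourhood, which may shrink
  with \<open>m\<close>; without it the iterates of \<^const>\<open>deriv\<close> would be meaningless, \<^const>\<open>deriv\<close> being total.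
\<close>

definition infinitely_differentiable_at :: "('a::real_normed_field \<Rightarrow> 'a) \<Rightarrow> 'a \<Rightarrow> bool" where
  "infinitely_differentiable_at f x \<longleftrightarrow>
     (\<forall>m. \<forall>\<^sub>F y in nhds x. (deriv ^^ m) f field_differentiable (at y))"

definition noncrossing :: "nat set set \<Rightarrow> bool" where
  "noncrossing \<pi> \<longleftrightarrow>
     (\<forall>V\<in>\<pi>. \<forall>W\<in>\<pi>. \<forall>p\<in>V. \<forall>q\<in>W. \<forall>r\<in>V. \<forall>s\<in>W. p < q \<and> q < r \<and> r < s \<longrightarrow> V = W)"

definition NC :: "nat \<Rightarrow> nat set set set" where
  "NC k = {\<pi>. partition_on {1..k} \<pi> \<and> noncrossing \<pi>}"

text \<open>Only used for \<open>m \<ge> 1\<close>.\<close>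

definition c_coeff :: "(nat \<Rightarrow> 'a::real_normed_field \<Rightarrow> 'a) \<Rightarrow> nat \<Rightarrow> nat \<Rightarrow> 'a" where
  "c_coeff \<Psi> i m = fact i * (deriv ^^ m) (\<Psi> i) 0 / fact (m - 1)"

text \<open>
  A tuple \<open>(b\<^sub>1, \<dots>, b\<^sub>n)\<close> is a function on \<open>{1..n}\<close>, made unique by \<open>\<rightarrow>\<^sub>E\<close>. The range of \<open>m\<close> is written
  without subtraction, so that it is empty when \<open>b\<^sub>1 + \<dots> + b\<^sub>n > k\<close>; all natural number
  subtractions below are then exact.
\<close>

definition mu :: "(nat \<Rightarrow> 'a::real_normed_field \<Rightarrow> 'a) \<Rightarrow> nat \<Rightarrow> nat \<Rightarrow> 'a" where
  "mu \<Psi> n k =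
     (\<Sum>b | b \<in> {1..n} \<rightarrow>\<^sub>E (UNIV :: nat set) \<and> (\<Sum>i=1..n. i * b i) = n.
       \<Sum>m | m + (\<Sum>i=1..n. b i) \<le> k.
         fact k / (fact m * fact (m + 1) * fact (k - m - (\<Sum>i=1..n. b i)) * (\<Prod>i=1..n. fact (b i)))
         * (deriv ^^ m)
             (\<lambda>x. deriv (\<Psi> 0) x ^ (k - m - (\<Sum>i=1..n. b i)) * (\<Prod>i=1..n. deriv (\<Psi> i) x ^ b i)) 0)"

end

theory Submission
  imports Defs "HOL-Computational_Algebra.Formal_Power_Series"
begin

text \<open>
  The theorem is the moment-cumulant formula for non-crossing partitions, with an extra formal
  variable \<open>t\<close>. Let \<open>f\<^sub>i\<close> be the Taylor series of \<open>\<Psi>\<^sub>i'\<close> at \<open>0\<close>, let \<open>F(x, t)\<close> be the sum of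
  \<open>t\<^sup>i f\<^sub>i(x)\<close> over \<open>i \<le> n\<close>, and let \<open>\<phi> = 1 + x F\<close>. Since \<open>c_coeff \<Psi> i s / i!\<close> is the coefficient
  of \<open>x\<^sup>s\<^sup>-\<^sup>1\<close> in \<open>f\<^sub>i\<close>, that is, of \<open>x\<^sup>s t\<^sup>i\<close> in \<open>\<phi>\<close>, the right-hand side of the theorem is the coefficient
  of \<open>t\<^sup>n\<close> in the sum over \<open>\<pi> \<in> NC k\<close> of the products of the \<open>[x\<^sup>s] \<phi>\<close>, with \<open>s\<close> running through the
  block sizes of \<open>\<pi>\<close>.

  On the left-hand side, Taylor series are multiplicative (\<open>taylor_mult\<close>), and the multinomial theorem
  collects the sum over \<open>b\<^sub>1, \<dots>, b\<^sub>n\<close> into a power of \<open>F\<close>; the remaining sum over \<open>m\<close> is a binomial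
  expansion, which gives \<open>(k + 1) mu \<Psi> n k = [t\<^sup>n x\<^sup>k] \<phi>\<^sup>k\<^sup>+\<^sup>1\<close> (\<open>mu_eq_coefficient\<close>).

  What remains is that the sum over \<open>NC k\<close> is \<open>[x\<^sup>k] \<phi>\<^sup>k\<^sup>+\<^sup>1 / (k + 1)\<close> (\<open>sum_NC_eq_coefficient\<close>).
  Removing blocks without gaps one at a time, from the right, turns a non-crossing partition into
  a lattice path that starts and ends at height \<open>0\<close>, never goes below it, and has one step
  \<open>1 - a\<close> for each element, \<open>a\<close> being the size of the block that begins there, or \<open>0\<close> if none does
  (\<open>sum_anchored_NC_eq_path_weight\<close>). These paths are evaluated by Lagrange inversion, in the form of
  a ballot theorem (\<open>path_weight_return\<close>).
\<close>

unbundle no vec_syntax and fps_syntax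

section \<open>Weighted lattice paths\<close>

text \<open>
  The total weight of the lattice paths with \<open>i\<close> steps that lead from height \<open>j\<close> to height \<open>0\<close> and
  stay at heights \<open>\<ge> 0\<close>, where a step changes the height by \<open>1 - a\<close> for some \<open>a \<ge> 0\<close> and has the
  weight \<open>w a\<close>. Bounding \<open>a\<close> by \<open>Suc j\<close> forbids the negative heights.
\<close>

fun path_weight :: "(nat \<Rightarrow> 'r::comm_ring_1) \<Rightarrow> nat \<Rightarrow> nat \<Rightarrow> 'r" where
  "path_weight w 0 j = (if j = 0 then 1 else 0)"
| "path_weight w (Suc i) j = (\<Sum>a\<le>Suc j. w a * path_weight w i (Suc j - a))"

text \<open>
  Divided by \<open>(p + 1) (p + 2)\<close>, this is the recursion in \<open>p\<close> of the ballot numbers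
  \<open>(j + 1) / (p + 1) \<cdot> [x\<^sup>p\<^sup>-\<^sup>j] \<phi>\<^sup>p\<^sup>+\<^sup>1\<close>, with \<open>d\<close> in place of \<open>j\<close>. It comes from
  \<open>\<phi>\<^sup>p\<^sup>+\<^sup>2 = \<phi> \<phi>\<^sup>p\<^sup>+\<^sup>1\<close>, which accounts for the summand \<open>d\<close> in \<open>d + a\<close>, and from applying the Euler
  operator \<open>x d/dx\<close> to \<open>\<phi>\<^sup>p\<^sup>+\<^sup>2\<close>, which accounts for the summand \<open>a\<close>.
\<close>

lemma fps_power_coeff_step:
  fixes \<phi> :: "'r::comm_ring_1 fps"
  assumes "d \<le> p + 1"
  shows "of_nat ((p + 1) * (d + 1)) * (\<phi> ^ (p + 2)) $ (p + 1 - d) =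
    of_nat (p + 2) * (\<Sum>a\<le>p + 1 - d. of_nat (d + a) * \<phi> $ a * (\<phi> ^ (p + 1)) $ (p + 1 - d - a))"
proof -
  define N where "N = p + 1 - d"
  define \<psi> where "\<psi> = \<phi> ^ (p + 1)"
  have pow: "\<phi> ^ (p + 2) = \<phi> * \<psi>" by (simp add: \<psi>_def)
  have coeff: "(\<phi> * \<psi>) $ N = (\<Sum>a\<le>N. \<phi> $ a * \<psi> $ (N - a))"
    by (simp add: fps_mult_nth atLeast0AtMost)
  have euler: "of_nat N * f $ N = (fps_X * fps_deriv f) $ N" for f :: "'r fps"
    by (cases N) auto
  have "of_nat N * (\<phi> ^ (p + 2)) $ N = (fps_X * fps_deriv (\<phi> ^ (p + 2))) $ N"
    using euler by blast
  also have "fps_X * fps_deriv (\<phi> ^ (p + 2)) = fps_const (of_nat (p + 2)) * ((fps_X * fps_deriv \<phi>) * \<psi>)"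
    by (simp only: fps_deriv_power) (simp add: \<psi>_def mult_ac)
  also have "\<dots> $ N = of_nat (p + 2) * (\<Sum>a\<le>N. of_nat a * \<phi> $ a * \<psi> $ (N - a))"
    unfolding fps_mult_left_const_nth fps_mult_nth[of "fps_X * _"] atLeast0AtMost
    by (intro arg_cong[where f="(*) _"] sum.cong refl) (case_tac x; simp)
  finally have deriv: "of_nat N * (\<phi> * \<psi>) $ N = of_nat (p + 2) * (\<Sum>a\<le>N. of_nat a * \<phi> $ a * \<psi> $ (N - a))"
    by (simp only: pow)
  have "of_nat (p + 2) * (\<Sum>a\<le>N. of_nat (d + a) * \<phi> $ a * \<psi> $ (N - a)) =
      of_nat ((p + 2) * d) * (\<phi> * \<psi>) $ N + of_nat N * (\<phi> * \<psi>) $ N"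
    unfolding deriv by (simp add: coeff algebra_simps sum.distrib sum_distrib_left)
  also have "\<dots> = of_nat ((p + 2) * d + N) * (\<phi> * \<psi>) $ N"
    by (simp only: of_nat_add distrib_right)
  also have "(p + 2) * d + N = (p + 1) * (d + 1)"
    using assms by (simp add: N_def algebra_simps)
  finally show ?thesis by (simp only: N_def \<psi>_def pow)
qed

text \<open>
  A form of Lagrange inversion. For \<open>\<phi> $ 0 = 1\<close> the ballot number
  \<open>(j + 1) / (p + 1) \<cdot> [x\<^sup>p\<^sup>-\<^sup>j] \<phi>\<^sup>p\<^sup>+\<^sup>1\<close> is the weight of the paths with \<open>p\<close> steps from height \<open>0\<close> to
  height \<open>j\<close>. Hence cutting the closed paths with \<open>k\<close> steps after \<open>p = k - i\<close> steps, and sorting them by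
  their height \<open>j\<close> there, should give a sum over \<open>j\<close> whose value does not depend on the cut. The
  proof verifies just this independence: the two extreme cuts \<open>p = 0\<close> and \<open>p = k\<close> are the two sides of
  the claim.
\<close>

lemma path_weight_return:
  fixes \<phi> :: "'r::{idom,semiring_char_0} fps"
  assumes \<phi>0: "\<phi> $ 0 = 1"
  shows "of_nat (k + 1) * path_weight (fps_nth \<phi>) k 0 = (\<phi> ^ (k + 1)) $ k"
proof -
  let ?b = "path_weight (fps_nth \<phi>)"
  \<comment> \<open>\<open>p + 1\<close> times the ballot number, so that no division is needed in the ring.\<close>
  define C where "C p j = of_nat (j + 1) * (\<phi> ^ (p + 1)) $ (p - j)" for p j :: nat
  define S where "S i = (\<Sum>j\<le>k - i. ?b i j * C (k - i) j)" for i
  have step: "of_nat (p + 1) * S i = of_nat (p + 2) * S (Suc i)" if p: "k - i = Suc p" for i p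
  proof -
    let ?g = "\<lambda>d a. of_nat (d + a) * ?b i d * \<phi> $ a * (\<phi> ^ (p + 1)) $ (p + 1 - (d + a))"
    have "of_nat (p + 1) * S i = (\<Sum>d\<le>p + 1. ?b i d *
        (of_nat ((p + 1) * (d + 1)) * (\<phi> ^ (p + 2)) $ (p + 1 - d)))"
      unfolding S_def p C_def sum_distrib_left
      by (intro sum.cong) (simp_all add: algebra_simps del: power_Suc)
    also have "\<dots> = of_nat (p + 2) * (\<Sum>d\<le>p + 1. \<Sum>a\<le>p + 1 - d. ?g d a)"
      unfolding sum_distrib_left
      by (intro sum.cong refl, subst fps_power_coeff_step)
         (auto simp: sum_distrib_left mult_ac intro!: sum.cong)
    \<comment> \<open>A step \<open>a\<close> that arrives at height \<open>d\<close> started at height \<open>j\<close> with \<open>d + a = j + 1\<close>.\<close>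
    also have "(\<Sum>d\<le>p + 1. \<Sum>a\<le>p + 1 - d. ?g d a) = (\<Sum>(a,d) | a + d \<le> p + 1. ?g d a)"
      by (subst sum.Sigma, simp, simp,
          rule sum.reindex_bij_witness[of _ "\<lambda>(a,d). (d,a)" "\<lambda>(d,a). (a,d)"]) auto
    also have "\<dots> = (\<Sum>s\<le>p + 1. \<Sum>a\<le>s. ?g (s - a) a)"
      by (rule sum.triangle_reindex_eq)
    \<comment> \<open>The only pair with \<open>d + a = 0\<close> would belong to height \<open>-1\<close>; its term has the factor \<open>0\<close>.\<close>
    also have "\<dots> = (\<Sum>j\<le>p. \<Sum>a\<le>Suc j. ?g (Suc j - a) a)"
      by (simp add: sum.atMost_Suc_shift[of _ p] del: sum.atMost_Suc)
    also have "\<dots> = S (Suc i)"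
    proof -
      have "k - Suc i = p" using p by simp
      then show ?thesis
        unfolding S_def C_def
        by (auto simp: sum_distrib_right sum_distrib_left mult_ac simp del: sum.atMost_Suc intro!: sum.cong)
    qed
    finally show ?thesis .
  qed
  have "of_nat (k + 1) * S i = of_nat (k - i + 1) * S 0" if "i \<le> k" for i
    using that
  proof (induction i)
    case (Suc i)
    then obtain p where p: "k - i = Suc p" by (metis Suc_diff_Suc Suc_le_lessD)
    then have "k - Suc i = p" by simp
    have "of_nat (p + 2) * (of_nat (k + 1) * S (Suc i)) = of_nat (k + 1) * (of_nat (p + 1) * S i)"
      by (simp only: step[OF p] mult.left_commute)
    also have "\<dots> = of_nat (p + 1) * (of_nat (k + 1) * S i)" by (simp only: mult_ac)
    also have "\<dots> = of_nat (p + 2) * (of_nat (p + 1) * S 0)"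
      using Suc p by (simp add: mult_ac)
    finally have "of_nat (k + 1) * S (Suc i) = of_nat (p + 1) * S 0"
      by (metis mult_left_cancel of_nat_eq_0_iff add_is_0 zero_neq_numeral)
    then show ?case by (simp only: \<open>k - Suc i = p\<close>)
  qed simp
  from this[of k] have "of_nat (k + 1) * S k = S 0" by simp
  moreover have "S k = ?b k 0" by (simp add: S_def C_def \<phi>0)
  moreover have "S 0 = (\<phi> ^ (k + 1)) $ k"
    by (simp add: S_def C_def if_distrib if_distribR sum.delta cong: if_cong)
  ultimately show ?thesis by simp
qed

section \<open>Non-crossing partitions as lattice paths\<close>

definition initial_segments :: "'b::linorder set \<Rightarrow> 'b set set" where
  "initial_segments X = {V. V \<noteq> {} \<and> V \<subseteq> X \<and> (\<forall>v\<in>V. \<forall>y\<in>X. y < v \<longrightarrow> y \<in> V)}"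

text \<open>
  Initial segments of a linear order form a chain, so they are determined by their sizes.
\<close>

lemma bij_betw_card_initial_segments:
  assumes "finite X"
  shows "bij_betw card (initial_segments X) {1..card X}"
proof -
  have fin: "finite V" if "V \<in> initial_segments X" for V
    using that assms by (auto simp: initial_segments_def intro: finite_subset)
  have chain: "V \<subseteq> W \<or> W \<subseteq> V" if "V \<in> initial_segments X" "W \<in> initial_segments X" for V W
  proof (rule ccontr)
    assume "\<not> ?thesis"
    then obtain v w where "v \<in> V" "v \<notin> W" "w \<in> W" "w \<notin> V" by blast
    with that show False by (cases v w rule: linorder_cases) (auto simp: initial_segments_def)
  qed
  have "inj_on card (initial_segments X)"
    by (rule inj_onI) (metis card_subset_eq chain fin)
  moreover have "card ` initial_segments X \<subseteq> {1..card X}"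
  proof clarify
    fix V assume V: "V \<in> initial_segments X"
    then have "V \<noteq> {}" "V \<subseteq> X" by (auto simp: initial_segments_def)
    with fin[OF V] assms show "card V \<in> {1..card X}"
      by (simp add: Suc_le_eq card_gt_0_iff card_mono)
  qed
  moreover have "\<exists>V\<in>initial_segments X. card V = a" if "a \<in> {1..card X}" for a
    using assms that
  proof (induction X rule: finite_linorder_max_induct)
    case (insert b A)
    then have "b \<notin> A" by auto
    show ?case
    proof (cases "a \<le> card A")
      case True
      then obtain V where "V \<in> initial_segments A" "card V = a" using insert by auto
      moreover have "V \<in> initial_segments (insert b A)"
        using insert(2) calculation(1) by (fastforce simp: initial_segments_def)
      ultimately show ?thesis by blast
    next
      case False
      then have "a = card (insert b A)" using insert \<open>b \<notin> A\<close> by auto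
      then show ?thesis by (intro bexI[of _ "insert b A"]) (auto simp: initial_segments_def)
    qed
  qed simp
  ultimately show ?thesis by (fastforce simp: bij_betw_def)
qed

text \<open>
  Used when every element of \<open>L\<close> is below every element of \<open>U\<close>: then the elements of \<open>U\<close> are those at
  the upper end that are not allowed to be the least element of their block.
\<close>

definition anchored_NC :: "nat set \<Rightarrow> nat set \<Rightarrow> nat set set set" where
  "anchored_NC L U = {\<pi>. partition_on (L \<union> U) \<pi> \<and> noncrossing \<pi> \<and> (\<forall>V\<in>\<pi>. V \<inter> L \<noteq> {})}"

lemma finite_anchored_NC: "finite L \<Longrightarrow> finite U \<Longrightarrow> finite (anchored_NC L U)"
  by (rule finite_subset[OF _ finitely_many_partition_on[of "L \<union> U"]]) (auto simp: anchored_NC_def)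

lemma noncrossingD:
  "noncrossing \<pi> \<Longrightarrow> V \<in> \<pi> \<Longrightarrow> W \<in> \<pi> \<Longrightarrow> p \<in> V \<Longrightarrow> q \<in> W \<Longrightarrow> r \<in> V \<Longrightarrow> s \<in> W \<Longrightarrow>
    p < q \<Longrightarrow> q < r \<Longrightarrow> r < s \<Longrightarrow> V = W"
  unfolding noncrossing_def by blast

text \<open>
  A block \<open>V\<close> whose least element \<open>x\<close> is the largest least element of all blocks has no gaps: an
  element \<open>y\<close> in a gap of \<open>V\<close> would lie in a block that begins before \<open>x\<close>, and that block
  would cross \<open>V\<close>. So \<open>V\<close> can be cut out, and what remains is a partition of the same kind.
\<close>

lemma anchored_NC_remove:
  assumes \<pi>: "\<pi> \<in> anchored_NC (insert x L) U" and V: "V \<in> \<pi>" "V \<inter> L = {}"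
    and less: "\<And>l. l \<in> L \<Longrightarrow> l < x" "\<And>u. u \<in> U \<Longrightarrow> x < u"
  shows "V \<in> initial_segments (insert x U)"
    and "\<pi> - {V} \<in> anchored_NC L (insert x U - V)"
proof -
  have part: "partition_on (L \<union> insert x U) \<pi>" and nc: "noncrossing \<pi>"
    and anch: "\<And>W. W \<in> \<pi> \<Longrightarrow> W \<inter> insert x L \<noteq> {}"
    using \<pi> by (auto simp: anchored_NC_def)
  have disj: "W = W'" if "W \<in> \<pi>" "W' \<in> \<pi>" "y \<in> W" "y \<in> W'" for W W' y
    using that part by (auto simp: partition_on_def disjoint_def)
  have xV: "x \<in> V" using anch V by blast
  have VU: "V \<subseteq> insert x U" using part V by (auto simp: partition_on_def)
  have meets: "W \<inter> L \<noteq> {}" if "W \<in> \<pi>" "W \<noteq> V" for W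
    using anch[OF that(1)] disj[OF that(1) V(1) _ xV] that(2) by blast
  have "y \<in> V" if v: "v \<in> V" and y: "y \<in> insert x U" "y < v" for v y
  proof (rule ccontr)
    assume "y \<notin> V"
    then have "x < y" using y xV less by auto
    obtain W where W: "W \<in> \<pi>" "y \<in> W" using part y by (auto simp: partition_on_def)
    then have "W \<noteq> V" using \<open>y \<notin> V\<close> by blast
    then obtain l where l: "l \<in> W" "l < x" using meets[OF W(1)] less by blast
    from noncrossingD[OF nc W(1) V(1) l(1) xV W(2) v l(2) \<open>x < y\<close> y(2)] \<open>W \<noteq> V\<close>
    show False by simp
  qed
  then show "V \<in> initial_segments (insert x U)"
    using xV VU by (auto simp: initial_segments_def)
  have "disjnt V (\<Union>(\<pi> - {V}))" using disj V(1) by (fastforce simp: disjnt_def)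
  moreover have "partition_on (L \<union> insert x U) (insert V (\<pi> - {V}))"
    using part V by (simp add: insert_absorb)
  ultimately have "partition_on ((L \<union> insert x U) - V) (\<pi> - {V})"
    using partition_on_insert by blast
  moreover have "(L \<union> insert x U) - V = L \<union> (insert x U - V)" using V by blast
  moreover have "noncrossing (\<pi> - {V})" using nc by (auto simp: noncrossing_def)
  ultimately show "\<pi> - {V} \<in> anchored_NC L (insert x U - V)"
    using meets by (auto simp: anchored_NC_def)
qed

text \<open>
  The converse: a block without gaps crosses nothing.
\<close>

lemma anchored_NC_insert:
  assumes V: "V \<in> initial_segments (insert x U)" and \<pi>: "\<pi> \<in> anchored_NC L (insert x U - V)"
    and less: "\<And>l. l \<in> L \<Longrightarrow> l < x" "\<And>u. u \<in> U \<Longrightarrow> x < u"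
  shows "insert V \<pi> \<in> anchored_NC (insert x L) U" and "V \<notin> \<pi>" and "V \<inter> L = {}"
proof -
  have part: "partition_on (L \<union> (insert x U - V)) \<pi>" and nc: "noncrossing \<pi>"
    and anch: "\<And>W. W \<in> \<pi> \<Longrightarrow> W \<inter> L \<noteq> {}"
    using \<pi> by (auto simp: anchored_NC_def)
  have VU: "V \<subseteq> insert x U" and V0: "V \<noteq> {}"
    and down: "\<And>v y. v \<in> V \<Longrightarrow> y \<in> insert x U \<Longrightarrow> y < v \<Longrightarrow> y \<in> V"
    using V by (auto simp: initial_segments_def)
  have xV: "x \<in> V" using V0 VU down less by (metis all_not_in_conv insertE insertI1 subset_iff)
  show VL: "V \<inter> L = {}" using VU less by force
  then show "V \<notin> \<pi>" using anch by blast
  have union: "\<Union>\<pi> = L \<union> (insert x U - V)" using part by (simp add: partition_on_def)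
  then have disj: "disjnt V (\<Union>\<pi>)" using VL by (auto simp: disjnt_def)
  have "(insert x L \<union> U) - V = L \<union> (insert x U - V)" using VL xV by blast
  then have "partition_on (insert x L \<union> U) (insert V \<pi>)"
    using part VU V0 by (subst partition_on_insert[OF disj]) auto
  moreover have convex: "False" if "v \<in> V" "v' \<in> V" "v < y" "y < v'" "y \<in> W" "W \<in> \<pi>" for v v' y W
  proof -
    have y: "y \<in> L \<union> (insert x U - V)" using that union by blast
    have "x \<le> v" using VU that(1) less by force
    then have "y \<notin> L" using less that by force
    then have "y \<in> V" using down[OF that(2) _ that(4)] y by blast
    then show False using y \<open>y \<notin> L\<close> by blast
  qed
  then have "noncrossing (insert V \<pi>)"
    unfolding noncrossing_def using noncrossingD[OF nc] by (metis insertE)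
  ultimately show "insert V \<pi> \<in> anchored_NC (insert x L) U"
    using anch xV by (auto simp: anchored_NC_def)
qed

text \<open>
  Both sides satisfy the same recursion. Let \<open>x\<close> be the largest element of \<open>L\<close>. If \<open>x\<close> is not the
  least element of its block, it may be moved from \<open>L\<close> to \<open>U\<close>; this is a step upwards, of weight
  \<open>w 0 = 1\<close>. If it is, then its block is one of the initial segments of \<open>insert x U\<close>, and there is
  exactly one of each size \<open>a\<close>; removing it replaces \<open>card U\<close> by \<open>card U + 1 - a\<close> and costs the
  factor \<open>w a\<close>.
\<close>

lemma sum_anchored_NC_eq_path_weight:
  fixes w :: "nat \<Rightarrow> 'r::comm_ring_1"
  assumes w0: "w 0 = 1" and "finite L" "finite U" and "\<And>l u. l \<in> L \<Longrightarrow> u \<in> U \<Longrightarrow> l < u"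
  shows "(\<Sum>\<pi>\<in>anchored_NC L U. \<Prod>V\<in>\<pi>. w (card V)) = path_weight w (card L) (card U)"
  using assms(2-)
proof (induction L arbitrary: U rule: finite_linorder_max_induct)
  case empty
  have "anchored_NC {} U = (if U = {} then {{}} else {})"
    by (auto simp: anchored_NC_def noncrossing_def partition_on_def)
  then show ?case using empty by auto
next
  case (insert x L)
  define X where "X = insert x U"
  have less: "\<And>l. l \<in> L \<Longrightarrow> l < x" "\<And>u. u \<in> U \<Longrightarrow> x < u" using insert by auto
  have "x \<notin> L" "x \<notin> U" using less by auto
  have fin: "finite X" "finite L" using insert by (auto simp: X_def)
  have finseg: "finite (initial_segments X)"
    by (rule finite_subset[of _ "Pow X"]) (use fin in \<open>auto simp: initial_segments_def\<close>)
  let ?f = "\<lambda>\<pi>. \<Prod>V\<in>\<pi>. w (card V)"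
  let ?I = "Sigma (initial_segments X) (\<lambda>V. anchored_NC L (X - V))"
  have LX: "l < u" if "l \<in> L" "u \<in> X" for l u using that less by (force simp: X_def)
  have IH: "(\<Sum>\<pi>\<in>anchored_NC L U'. ?f \<pi>) = path_weight w (card L) (card U')" if "U' \<subseteq> X" for U'
    using insert.IH[of U'] fin that LX by (meson finite_subset subsetD)
  have ins: "insert V \<pi> \<in> anchored_NC (insert x L) U" "V \<notin> \<pi>" "V \<inter> L = {}"
    if "V \<in> initial_segments X" "\<pi> \<in> anchored_NC L (X - V)" for V \<pi>
    using anchored_NC_insert[of V x U \<pi> L] that less unfolding X_def by blast+
  have split: "anchored_NC (insert x L) U =
      anchored_NC L X \<union> (\<lambda>(V, \<pi>). insert V \<pi>) ` ?I"
  proof (intro equalityI subsetI)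
    fix \<pi> assume \<pi>: "\<pi> \<in> anchored_NC (insert x L) U"
    show "\<pi> \<in> anchored_NC L X \<union> (\<lambda>(V, \<pi>). insert V \<pi>) ` ?I"
    proof (cases "\<forall>V\<in>\<pi>. V \<inter> L \<noteq> {}")
      case True
      then show ?thesis using \<pi> by (auto simp: anchored_NC_def X_def)
    next
      case False
      then obtain V where V: "V \<in> \<pi>" "V \<inter> L = {}" by blast
      have "(V, \<pi> - {V}) \<in> ?I"
        using anchored_NC_remove[OF \<pi> V less] by (simp add: X_def)
      moreover have "\<pi> = insert V (\<pi> - {V})" using V by blast
      ultimately show ?thesis by (metis (mono_tags, lifting) UnI2 case_prod_conv image_eqI)
    qed
  next
    fix \<pi> assume "\<pi> \<in> anchored_NC L X \<union> (\<lambda>(V, \<pi>). insert V \<pi>) ` ?I"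
    then show "\<pi> \<in> anchored_NC (insert x L) U"
      using ins(1) by (auto simp: anchored_NC_def X_def)
  qed
  have new: "V \<notin> \<pi>" "V \<inter> L = {}" if "(V, \<pi>) \<in> ?I" for V \<pi>
    using ins(2,3)[of V \<pi>] that by simp_all
  have old: "W \<inter> L \<noteq> {}" if "W \<in> \<pi>" "\<pi> \<in> anchored_NC L U'" for W \<pi> U'
    using that by (auto simp: anchored_NC_def)
  have inj: "inj_on (\<lambda>(V, \<pi>). insert V \<pi>) ?I"
  proof (rule inj_onI, clarify)
    fix V \<pi> V' \<pi>' assume *: "V \<in> initial_segments X" "\<pi> \<in> anchored_NC L (X - V)"
      "V' \<in> initial_segments X" "\<pi>' \<in> anchored_NC L (X - V')" "insert V \<pi> = insert V' \<pi>'"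
    have VL: "V \<inter> L = {}" "V' \<inter> L = {}" using ins(3) *(1-4) by blast+
    then have "V' \<notin> \<pi>" "V \<notin> \<pi>'" using old[of V' \<pi>] old[of V \<pi>'] *(2,4) by blast+
    moreover have "V \<notin> \<pi>" "V' \<notin> \<pi>'" using ins(2) *(1-4) by blast+
    ultimately show "V = V' \<and> \<pi> = \<pi>'" using *(5) by (metis insert_iff insert_ident)
  qed
  have disjoint: "anchored_NC L X \<inter> (\<lambda>(V, \<pi>). insert V \<pi>) ` ?I = {}"
  proof -
    have "insert V \<pi> \<notin> anchored_NC L X" if "(V, \<pi>) \<in> ?I" for V \<pi>
      using new(2)[OF that] old[of V "insert V \<pi>" X] by blast
    then show ?thesis by auto
  qed
  have finI: "finite ?I" using finseg fin by (auto intro: finite_anchored_NC)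
  have reindex: "(\<Sum>\<pi>\<in>(\<lambda>(V, \<pi>). insert V \<pi>) ` ?I. ?f \<pi>) = (\<Sum>(V, \<pi>)\<in>?I. ?f (insert V \<pi>))"
    unfolding sum.reindex[OF inj] by (simp add: o_def split_def)
  have "(\<Sum>\<pi>\<in>anchored_NC (insert x L) U. ?f \<pi>) =
      (\<Sum>\<pi>\<in>anchored_NC L X. ?f \<pi>) + (\<Sum>(V, \<pi>)\<in>?I. ?f (insert V \<pi>))"
    unfolding split reindex[symmetric]
    by (rule sum.union_disjoint[OF finite_anchored_NC[OF fin(2,1)] finite_imageI[OF finI] disjoint])
  also have "(\<Sum>(V, \<pi>)\<in>?I. ?f (insert V \<pi>)) = (\<Sum>(V, \<pi>)\<in>?I. w (card V) * ?f \<pi>)"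
  proof (intro sum.cong refl, clarify)
    fix V \<pi> assume *: "V \<in> initial_segments X" "\<pi> \<in> anchored_NC L (X - V)"
    then have "finite \<pi>"
      using fin finite_elements[of "L \<union> (X - V)" \<pi>] by (auto simp: anchored_NC_def)
    then show "?f (insert V \<pi>) = w (card V) * ?f \<pi>" using new[of V \<pi>] * by simp
  qed
  also have "\<dots> = (\<Sum>V\<in>initial_segments X. w (card V) * (\<Sum>\<pi>\<in>anchored_NC L (X - V). ?f \<pi>))"
    using finseg fin by (subst sum.Sigma[symmetric]) (auto simp: finite_anchored_NC sum_distrib_left)
  also have "\<dots> = (\<Sum>V\<in>initial_segments X. w (card V) * path_weight w (card L) (card X - card V))"
  proof (intro sum.cong refl)
    fix V assume "V \<in> initial_segments X"
    then have "V \<subseteq> X" by (simp add: initial_segments_def)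
    then show "w (card V) * (\<Sum>\<pi>\<in>anchored_NC L (X - V). ?f \<pi>)
        = w (card V) * path_weight w (card L) (card X - card V)"
      using fin(1) by (simp add: IH card_Diff_subset finite_subset)
  qed
  also have "\<dots> = (\<Sum>a\<in>{1..card X}. w a * path_weight w (card L) (card X - a))"
    by (rule sum.reindex_bij_betw[OF bij_betw_card_initial_segments[OF fin(1)]])
  also have "(\<Sum>\<pi>\<in>anchored_NC L X. ?f \<pi>) = w 0 * path_weight w (card L) (card X - 0)"
    using IH[of X] w0 by simp
  also have "w 0 * path_weight w (card L) (card X - 0) + (\<Sum>a\<in>{1..card X}. w a * path_weight w (card L) (card X - a))
      = (\<Sum>a\<le>card X. w a * path_weight w (card L) (card X - a))"
    by (simp add: atMost_atLeast0 sum.atLeast_Suc_atMost)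
  also have "\<dots> = path_weight w (card (insert x L)) (card U)"
    using insert(4) fin \<open>x \<notin> L\<close> \<open>x \<notin> U\<close> by (simp add: X_def)
  finally show ?case .
qed

text \<open>
  The moment-cumulant formula of free probability: the left-hand sum is the \<open>k\<close>-th moment belonging
  to the free cumulants \<open>\<phi> $ 1, \<phi> $ 2, \<dots>\<close>.
\<close>

lemma sum_NC_eq_coefficient:
  fixes \<phi> :: "'r::{idom,semiring_char_0} fps"
  assumes "\<phi> $ 0 = 1"
  shows "of_nat (k + 1) * (\<Sum>\<pi>\<in>NC k. \<Prod>V\<in>\<pi>. \<phi> $ card V) = (\<phi> ^ (k + 1)) $ k"
proof -
  have "NC k = anchored_NC {1..k} {}"
  proof -
    have "V \<inter> {1..k} \<noteq> {}" if "partition_on {1..k} \<pi>" "V \<in> \<pi>" for V \<pi>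
      using that by (metis inf.absorb1 partition_on_def Union_upper)
    then show ?thesis by (auto simp: NC_def anchored_NC_def)
  qed
  then show ?thesis
    using sum_anchored_NC_eq_path_weight[of "fps_nth \<phi>" "{1..k}" "{}"] path_weight_return[OF assms, of k] assms
    by simp
qed

section \<open>Taylor series of products\<close>

text \<open>
  The induction step of the Leibniz rule, with \<open>F i\<close> and \<open>G i\<close> standing for \<open>i\<close>-th derivatives.
\<close>

lemma Pascal_convolution:
  fixes F G :: "nat \<Rightarrow> 'a::comm_ring_1"
  shows "(\<Sum>i\<le>Suc m. of_nat (Suc m choose i) * (F i * G (Suc m - i))) =
    (\<Sum>i\<le>m. of_nat (m choose i) * (F (Suc i) * G (m - i) + F i * G (Suc (m - i))))"
proof -
  have "(\<Sum>i\<le>Suc m. of_nat (Suc m choose i) * (F i * G (Suc m - i))) =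
      F 0 * G (Suc m) + (\<Sum>i\<le>m. of_nat (m choose i) * (F (Suc i) * G (m - i)))
      + (\<Sum>i\<le>m. of_nat (m choose Suc i) * (F (Suc i) * G (m - i)))"
    by (simp add: sum.atMost_Suc_shift[of _ m] algebra_simps sum.distrib del: sum.atMost_Suc)
  also have "F 0 * G (Suc m) + (\<Sum>i\<le>m. of_nat (m choose i) * (F (Suc i) * G (m - i)))
      + (\<Sum>i\<le>m. of_nat (m choose Suc i) * (F (Suc i) * G (m - i)))
    = (\<Sum>i\<le>m. of_nat (m choose i) * (F (Suc i) * G (m - i)))
      + (\<Sum>i\<le>Suc m. of_nat (m choose i) * (F i * G (Suc m - i)))"
    by (simp add: sum.atMost_Suc_shift[of _ m] algebra_simps del: sum.atMost_Suc)
  also have "(\<Sum>i\<le>Suc m. of_nat (m choose i) * (F i * G (Suc m - i))) =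
      (\<Sum>i\<le>m. of_nat (m choose i) * (F i * G (Suc (m - i))))"
    by (simp add: binomial_eq_0 Suc_diff_le)
  finally show ?thesis
    by (simp add: algebra_simps sum.distrib)
qed

lemma infinitely_differentiable_at_iterate:
  "infinitely_differentiable_at f x \<Longrightarrow> infinitely_differentiable_at ((deriv ^^ j) f) x"
  by (simp add: infinitely_differentiable_at_def flip: funpow_add[THEN fun_cong, unfolded o_apply])

lemma DERIV_iterate:
  assumes "infinitely_differentiable_at f x"
  shows "\<forall>\<^sub>F y in nhds x. \<forall>i\<le>m. ((deriv ^^ i) f has_field_derivative (deriv ^^ Suc i) f y) (at y)"
proof -
  have "\<forall>\<^sub>F y in nhds x. \<forall>i\<in>{..m}. (deriv ^^ i) f field_differentiable (at y)"
    using assms by (intro eventually_ball_finite) (auto simp: infinitely_differentiable_at_def)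
  then show ?thesis
    by eventually_elim (auto simp: DERIV_deriv_iff_field_differentiable)
qed

text \<open>
  The formula is claimed near \<open>x\<close> and not only at \<open>x\<close>, because the induction differentiates it.
\<close>

lemma Leibniz_rule:
  assumes f: "infinitely_differentiable_at f x" and g: "infinitely_differentiable_at g x"
  shows "\<forall>\<^sub>F y in nhds x. (deriv ^^ m) (\<lambda>z. f z * g z) y =
    (\<Sum>i\<le>m. of_nat (m choose i) * ((deriv ^^ i) f y * (deriv ^^ (m - i)) g y))"
proof (induction m)
  case (Suc m)
  then have "\<forall>\<^sub>F y in nhds x. \<forall>\<^sub>F z in nhds y. (deriv ^^ m) (\<lambda>z. f z * g z) z =
      (\<Sum>i\<le>m. of_nat (m choose i) * ((deriv ^^ i) f z * (deriv ^^ (m - i)) g z))"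
    by (simp only: eventually_eventually)
  then show ?case
    using DERIV_iterate[OF f, of m] DERIV_iterate[OF g, of m]
  proof eventually_elim
    case (elim y)
    let ?D = "(\<Sum>i\<le>m. of_nat (m choose i) * ((deriv ^^ Suc i) f y * (deriv ^^ (m - i)) g y
      + (deriv ^^ i) f y * (deriv ^^ Suc (m - i)) g y))"
    have "(deriv ^^ Suc m) (\<lambda>z. f z * g z) y =
        deriv (\<lambda>z. \<Sum>i\<le>m. of_nat (m choose i) * ((deriv ^^ i) f z * (deriv ^^ (m - i)) g z)) y"
      using elim(1) by (simp add: deriv_cong_ev)
    also have "\<dots> = ?D"
    proof (rule DERIV_imp_deriv, rule DERIV_sum, rule DERIV_cmult)
      fix i assume "i \<in> {..m}"
      then show "((\<lambda>z. (deriv ^^ i) f z * (deriv ^^ (m - i)) g z) has_field_derivative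
          (deriv ^^ Suc i) f y * (deriv ^^ (m - i)) g y
          + (deriv ^^ i) f y * (deriv ^^ Suc (m - i)) g y) (at y)"
        using DERIV_mult'[of "(deriv ^^ i) f" _ y _ "(deriv ^^ (m - i)) g"] elim(2,3)
        by (simp add: add.commute)
    qed
    also have "\<dots> = (\<Sum>i\<le>Suc m. of_nat (Suc m choose i) * ((deriv ^^ i) f y * (deriv ^^ (Suc m - i)) g y))"
      by (rule Pascal_convolution[symmetric])
    finally show ?case .
  qed
qed simp

lemma infinitely_differentiable_at_mult:
  assumes f: "infinitely_differentiable_at f x" and g: "infinitely_differentiable_at g x"
  shows "infinitely_differentiable_at (\<lambda>z. f z * g z) x"
  unfolding infinitely_differentiable_at_def
proof
  fix m
  have "\<forall>\<^sub>F y in nhds x. \<forall>\<^sub>F z in nhds y. (deriv ^^ m) (\<lambda>z. f z * g z) z =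
      (\<Sum>i\<le>m. of_nat (m choose i) * ((deriv ^^ i) f z * (deriv ^^ (m - i)) g z))"
    unfolding eventually_eventually by (rule Leibniz_rule[OF f g])
  then show "\<forall>\<^sub>F y in nhds x. (deriv ^^ m) (\<lambda>z. f z * g z) field_differentiable at y"
    using DERIV_iterate[OF f, of m] DERIV_iterate[OF g, of m]
  proof eventually_elim
    case (elim y)
    have "(\<lambda>z. \<Sum>i\<le>m. of_nat (m choose i) * ((deriv ^^ i) f z * (deriv ^^ (m - i)) g z))
        field_differentiable at y"
    proof (intro derivative_intros)
      fix i assume "i \<in> {..m}"
      then show "(deriv ^^ i) f field_differentiable at y" "(deriv ^^ (m - i)) g field_differentiable at y"
        using elim(2,3) unfolding field_differentiable_def by (meson atMost_iff diff_le_self)+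
    qed
    then obtain D where "((\<lambda>z. \<Sum>i\<le>m. of_nat (m choose i) * ((deriv ^^ i) f z * (deriv ^^ (m - i)) g z))
        has_field_derivative D) (at y)"
      by (auto simp: field_differentiable_def)
    then have "((deriv ^^ m) (\<lambda>z. f z * g z) has_field_derivative D) (at y)"
      using DERIV_cong_ev[OF refl elim(1) refl] by blast
    then show ?case by (auto simp: field_differentiable_def)
  qed
qed

definition taylor :: "('a::real_normed_field \<Rightarrow> 'a) \<Rightarrow> 'a fps" where
  "taylor f = Abs_fps (\<lambda>m. (deriv ^^ m) f 0 / fact m)"

lemma taylor_mult:
  assumes "infinitely_differentiable_at f 0" and "infinitely_differentiable_at g 0"
  shows "taylor (\<lambda>x. f x * g x) = taylor f * taylor g"
proof (rule fps_ext)
  fix m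
  have "taylor (\<lambda>x. f x * g x) $ m =
      (\<Sum>i\<le>m. of_nat (m choose i) * ((deriv ^^ i) f 0 * (deriv ^^ (m - i)) g 0)) / fact m"
    using eventually_nhds_x_imp_x[OF Leibniz_rule[OF assms]] by (simp add: taylor_def)
  also have "\<dots> = (\<Sum>i\<le>m. taylor f $ i * taylor g $ (m - i))"
    unfolding sum_divide_distrib by (intro sum.cong refl) (simp add: taylor_def binomial_fact)
  finally show "taylor (\<lambda>x. f x * g x) $ m = (taylor f * taylor g) $ m"
    by (simp add: fps_mult_nth atLeast0AtMost)
qed

lemma infinitely_differentiable_at_const: "infinitely_differentiable_at (\<lambda>_. c) x"
proof -
  have "(deriv ^^ m) (\<lambda>_. c) = (if m = 0 then (\<lambda>_. c) else (\<lambda>_. 0))" for m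
    by (induction m) auto
  then show ?thesis by (simp add: infinitely_differentiable_at_def)
qed

lemma taylor_1: "taylor (\<lambda>_. 1) = 1"
proof -
  have "(deriv ^^ m) (\<lambda>_. 1) = (if m = 0 then (\<lambda>_. 1) else (\<lambda>_. 0 :: 'a))" for m
    by (induction m) auto
  then show ?thesis by (simp add: taylor_def fps_eq_iff)
qed

lemma taylor_prod:
  assumes "finite I" "\<And>i. i \<in> I \<Longrightarrow> infinitely_differentiable_at (f i) 0"
  shows "infinitely_differentiable_at (\<lambda>x. \<Prod>i\<in>I. f i x) 0 \<and>
    taylor (\<lambda>x. \<Prod>i\<in>I. f i x) = (\<Prod>i\<in>I. taylor (f i))"
  using assms
  by (induction I rule: finite_induct)
     (auto simp: infinitely_differentiable_at_const taylor_1 taylor_mult infinitely_differentiable_at_mult)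

lemma taylor_power:
  assumes "infinitely_differentiable_at f 0"
  shows "infinitely_differentiable_at (\<lambda>x. f x ^ q) 0 \<and> taylor (\<lambda>x. f x ^ q) = taylor f ^ q"
  using taylor_prod[of "{..<q}" "\<lambda>_. f"] assms by simp

section \<open>Coefficients of products and of powers of sums\<close>

lemma finite_PiE_sum_le:
  assumes "finite I"
  shows "finite {l. l \<in> I \<rightarrow>\<^sub>E (UNIV :: nat set) \<and> sum l I \<le> n}"
proof (rule finite_subset)
  have "l i \<le> n" if "sum l I \<le> n" "i \<in> I" for l i
    using member_le_sum[of i I l] that assms by simp
  then show "{l. l \<in> I \<rightarrow>\<^sub>E UNIV \<and> sum l I \<le> n} \<subseteq> I \<rightarrow>\<^sub>E {..n}"
    by (auto simp: PiE_def)
  show "finite (I \<rightarrow>\<^sub>E {..n})" using assms by (simp add: finite_PiE)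
qed

lemma fps_prod_nth_PiE:
  fixes g :: "'b \<Rightarrow> 'a::comm_ring_1 fps"
  assumes "finite I"
  shows "(\<Prod>i\<in>I. g i) $ n = (\<Sum>l | l \<in> I \<rightarrow>\<^sub>E (UNIV :: nat set) \<and> sum l I = n. \<Prod>i\<in>I. g i $ l i)"
  using assms
proof (induction I arbitrary: n rule: finite_induct)
  case empty
  show ?case by (cases n) (auto simp: sum.neutral Collect_conv_if)
next
  case (insert j I)
  let ?P = "\<lambda>I n. {l. l \<in> I \<rightarrow>\<^sub>E (UNIV :: nat set) \<and> sum l I = n}"
  have fin: "finite (?P I n)" for n
    by (rule finite_subset[OF _ finite_PiE_sum_le[OF insert(1), of n]]) auto
  have "(\<Prod>i\<in>insert j I. g i) $ n =
      (\<Sum>c\<le>n. \<Sum>l\<in>?P I (n - c). g j $ c * (\<Prod>i\<in>I. g i $ l i))"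
    using insert by (simp add: fps_mult_nth atLeast0AtMost sum_distrib_left)
  also have "\<dots> = (\<Sum>(c,l)\<in>Sigma {..n} (\<lambda>c. ?P I (n - c)). g j $ c * (\<Prod>i\<in>I. g i $ l i))"
    using fin by (subst sum.Sigma) auto
  also have "\<dots> = (\<Sum>l\<in>?P (insert j I) n. \<Prod>i\<in>insert j I. g i $ l i)"
  proof (rule sum.reindex_bij_witness[of _ "\<lambda>l. (l j, restrict l I)" "\<lambda>(c,l). l(j := c)"])
    have upd: "sum (l(j := c)) I = sum l I" "(\<Prod>i\<in>I. g i $ (l(j := c)) i) = (\<Prod>i\<in>I. g i $ l i)"
      for l :: "'b \<Rightarrow> nat" and c
      using insert(2) by (auto intro!: sum.cong prod.cong)
    fix a assume "a \<in> Sigma {..n} (\<lambda>c. ?P I (n - c))"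
    then show "(case a of (c,l) \<Rightarrow> l(j := c)) \<in> ?P (insert j I) n"
      "(\<lambda>l. (l j, restrict l I)) (case a of (c,l) \<Rightarrow> l(j := c)) = a"
      "(\<lambda>l. \<Prod>i\<in>insert j I. g i $ l i) (case a of (c,l) \<Rightarrow> l(j := c)) =
        (case a of (c,l) \<Rightarrow> g j $ c * (\<Prod>i\<in>I. g i $ l i))"
      using insert(1,2) upd by (auto simp: PiE_iff extensional_def fun_eq_iff)
  qed (use insert(1,2) in \<open>auto simp: PiE_iff extensional_def fun_eq_iff\<close>)
  finally show ?case .
qed

text \<open>
  The multinomial theorem, with the exponent of \<open>y0\<close> expressed by the others. The homomorphism \<open>h\<close>
  supplies the inverse factorials in rings that are not fields, such as power series. In the
  induction on \<open>I\<close> the variable \<open>y0\<close> absorbs the new \<open>y j\<close>, which is then split off again by the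
  binomial theorem; this is why \<open>y0\<close> is kept separate.
\<close>

lemma multinomial_expansion:
  fixes h :: "'a::field_char_0 \<Rightarrow> 'b::comm_ring_1"
  assumes h: "\<And>a b. h (a * b) = h a * h b" "\<And>a b. h (a + b) = h a + h b" "h 1 = 1"
    and "finite I"
  shows "h (1 / fact q) * (y0 + (\<Sum>i\<in>I. y i)) ^ q =
    (\<Sum>b | b \<in> I \<rightarrow>\<^sub>E (UNIV :: nat set) \<and> sum b I \<le> q.
       h (1 / (fact (q - sum b I) * (\<Prod>i\<in>I. fact (b i)))) * (y0 ^ (q - sum b I) * (\<Prod>i\<in>I. y i ^ b i)))"
  using assms(4)
proof (induction I arbitrary: y0 rule: finite_induct)
  case empty
  show ?case by (auto simp: Collect_conv_if)
next
  case (insert j I)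
  let ?P = "\<lambda>I q. {b. b \<in> I \<rightarrow>\<^sub>E (UNIV :: nat set) \<and> sum b I \<le> q}"
  have fin: "finite (?P I q)" for q
    by (rule finite_PiE_sum_le[OF insert(1)])
  have h_of_nat: "h (of_nat m) = of_nat m" for m
  proof (induction m)
    case 0
    show ?case using h(2)[of 0 0] by simp
  qed (simp add: h)
  have binom: "h (1 / fact r) * (y0 + y j) ^ r =
      (\<Sum>c\<le>r. h (1 / (fact (r - c) * fact c)) * (y0 ^ (r - c) * y j ^ c))" for r
  proof -
    have "h (1 / (fact (r - c) * fact c)) = h (1 / fact r) * of_nat (r choose c)" if "c \<le> r" for c
      unfolding h_of_nat[symmetric] h(1)[symmetric] using that by (simp add: binomial_fact mult.commute)
    then show ?thesis
      by (subst add.commute, subst binomial_ring) (auto simp: sum_distrib_left mult_ac intro!: sum.cong)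
  qed
  let ?t = "\<lambda>b c. h (1 / (fact (q - sum b I - c) * (fact c * (\<Prod>i\<in>I. fact (b i))))) *
     (y0 ^ (q - sum b I - c) * (y j ^ c * (\<Prod>i\<in>I. y i ^ b i)))"
  have "h (1 / fact q) * (y0 + (\<Sum>i\<in>insert j I. y i)) ^ q = (\<Sum>b\<in>?P I q. 
       h (1 / (fact (q - sum b I) * (\<Prod>i\<in>I. fact (b i)))) * ((y0 + y j) ^ (q - sum b I) * (\<Prod>i\<in>I. y i ^ b i)))"
    using insert.IH[of "y0 + y j"] insert(1,2) by (simp add: add.assoc)
  also have "\<dots> = (\<Sum>b\<in>?P I q. \<Sum>c\<le>q - sum b I. ?t b c)"
  proof (intro sum.cong refl)
    fix b
    let ?r = "q - sum b I" and ?p = "\<Prod>i\<in>I. fact (b i) :: 'a" and ?y = "\<Prod>i\<in>I. y i ^ b i"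
    have "h (1 / (fact ?r * ?p)) * ((y0 + y j) ^ ?r * ?y) = (h (1 / fact ?r) * (y0 + y j) ^ ?r) * (h (1 / ?p) * ?y)"
      using h(1)[of "1 / fact ?r" "1 / ?p"] by (simp add: mult_ac)
    also have "\<dots> = (\<Sum>c\<le>?r. ?t b c)"
      unfolding binom sum_distrib_right
    proof (intro sum.cong refl)
      fix c
      show "h (1 / (fact (?r - c) * fact c)) * (y0 ^ (?r - c) * y j ^ c) * (h (1 / ?p) * ?y) = ?t b c"
        using h(1)[of "1 / (fact (?r - c) * fact c)" "1 / ?p"] by (simp add: mult_ac)
    qed
    finally show "h (1 / (fact ?r * ?p)) * ((y0 + y j) ^ ?r * ?y) = (\<Sum>c\<le>?r. ?t b c)" .
  qed
  also have "\<dots> = (\<Sum>(b,c)\<in>Sigma (?P I q) (\<lambda>b. {..q - sum b I}). ?t b c)"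
    using fin by (subst sum.Sigma) auto
  also have "\<dots> = (\<Sum>b\<in>?P (insert j I) q. h (1 / (fact (q - sum b (insert j I)) * (\<Prod>i\<in>insert j I. fact (b i))))
     * (y0 ^ (q - sum b (insert j I)) * (\<Prod>i\<in>insert j I. y i ^ b i)))"
  proof (rule sum.reindex_bij_witness[of _ "\<lambda>b. (restrict b I, b j)" "\<lambda>(b,c). b(j := c)"])
    have upd: "sum (b(j := c)) I = sum b I" "(\<Prod>i\<in>I. fact ((b(j := c)) i) :: 'a) = (\<Prod>i\<in>I. fact (b i))"
      "(\<Prod>i\<in>I. y i ^ (b(j := c)) i) = (\<Prod>i\<in>I. y i ^ b i)" for b :: "'c \<Rightarrow> nat" and c
      using insert(2) by (auto intro!: sum.cong prod.cong)
    fix a assume "a \<in> Sigma (?P I q) (\<lambda>b. {..q - sum b I})"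
    then show "(case a of (b,c) \<Rightarrow> b(j := c)) \<in> ?P (insert j I) q"
      "(\<lambda>b. (restrict b I, b j)) (case a of (b,c) \<Rightarrow> b(j := c)) = a"
      using insert(1,2) upd by (auto simp: PiE_iff extensional_def fun_eq_iff)
    show "(\<lambda>b. h (1 / (fact (q - sum b (insert j I)) * (\<Prod>i\<in>insert j I. fact (b i))))
       * (y0 ^ (q - sum b (insert j I)) * (\<Prod>i\<in>insert j I. y i ^ b i))) (case a of (b,c) \<Rightarrow> b(j := c)) = (case a of (b,c) \<Rightarrow> ?t b c)"
      using insert(1,2) upd by (auto simp: add.commute split: prod.split)
  qed (use insert(1,2) in \<open>auto simp: PiE_iff extensional_def fun_eq_iff\<close>)
  finally show ?case .
qed

section \<open>The generating function of the family\<close>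

text \<open>
  A power series in \<open>x\<close>, regarded as one in \<open>x\<close> whose coefficients are (constant) power series in a
  second variable \<open>t\<close>.
\<close>

definition fps_lift :: "'a::comm_ring_1 fps \<Rightarrow> 'a fps fps" where
  "fps_lift f = Abs_fps (\<lambda>m. fps_const (f $ m))"

lemma fps_lift_nth [simp]: "fps_lift f $ m = fps_const (f $ m)"
  by (simp add: fps_lift_def)

lemma fps_lift_1: "fps_lift 1 = 1"
  by (simp add: fps_eq_iff)

lemma fps_lift_mult: "fps_lift (f * g) = fps_lift f * fps_lift g"
proof -
  have "fps_const (\<Sum>i\<in>A. h i) = (\<Sum>i\<in>A. fps_const (h i))" for A :: "nat set" and h :: "nat \<Rightarrow> 'a"
    by (simp add: fps_eq_iff fps_sum_nth)
  then show ?thesis by (intro fps_ext) (simp add: fps_mult_nth)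
qed

lemma fps_lift_power: "fps_lift (f ^ q) = fps_lift f ^ q"
  by (induction q) (simp_all add: fps_lift_1 fps_lift_mult)

lemma fps_lift_prod: "fps_lift (\<Prod>i\<in>I. f i) = (\<Prod>i\<in>I. fps_lift (f i))"
  by (induction I rule: infinite_finite_induct) (simp_all add: fps_lift_1 fps_lift_mult)

text \<open>
  The sum of \<open>t\<^sup>i f\<^sub>i(x)\<close> over \<open>i \<le> n\<close>. The term for \<open>i = 0\<close> is kept separate because the exponent of
  \<open>f\<^sub>0\<close> is determined by the other exponents in the sums below.
\<close>

definition family_fps :: "(nat \<Rightarrow> 'a::comm_ring_1 fps) \<Rightarrow> nat \<Rightarrow> 'a fps fps" where
  "family_fps f n = fps_lift (f 0) + (\<Sum>i\<in>{1..n}. fps_const (fps_X ^ i) * fps_lift (f i))"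

lemma family_fps_nth_nth:
  "family_fps f n $ m $ i = (if i \<le> n then f i $ m else 0)"
  by (cases "i = 0") (simp_all add: family_fps_def fps_sum_nth mult_delta_left)

text \<open>
  In the multinomial expansion, the monomial with exponents \<open>b\<close> carries \<open>t\<close> to the power
  \<open>b\<^sub>1 + 2 b\<^sub>2 + \<dots> + n b\<^sub>n\<close>, so the coefficient of \<open>t\<^sup>n\<close> selects the tuples for which this is \<open>n\<close>.
\<close>

lemma family_fps_power_nth_nth:
  fixes f :: "nat \<Rightarrow> 'a::field_char_0 fps"
  shows "(family_fps f n ^ q) $ m $ n / fact q =
    (\<Sum>b | (b \<in> {1..n} \<rightarrow>\<^sub>E (UNIV :: nat set) \<and> (\<Sum>i=1..n. i * b i) = n) \<and> sum b {1..n} \<le> q.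
       (f 0 ^ (q - sum b {1..n}) * (\<Prod>i=1..n. f i ^ b i)) $ m
         / (fact (q - sum b {1..n}) * (\<Prod>i=1..n. fact (b i))))"
proof -
  let ?h = "\<lambda>c :: 'a. fps_const (fps_const c)"
  let ?y = "\<lambda>i. fps_const (fps_X ^ i) * fps_lift (f i)"
  let ?B = "\<lambda>b. sum b {1..n}"
  let ?c = "\<lambda>b. 1 / (fact (q - ?B b) * (\<Prod>i\<in>{1..n}. fact (b i))) :: 'a"
  let ?f = "\<lambda>b. f 0 ^ (q - ?B b) * (\<Prod>i\<in>{1..n}. f i ^ b i)"
  let ?P = "{b. b \<in> {1..n} \<rightarrow>\<^sub>E (UNIV :: nat set) \<and> ?B b \<le> q}"
  have const_prod: "(\<Prod>i\<in>A. fps_const (g i)) = fps_const (\<Prod>i\<in>A. g i)"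
    for A and g :: "nat \<Rightarrow> 'a fps"
    by (induction A rule: infinite_finite_induct) simp_all
  have monomial: "fps_lift (f 0) ^ (q - ?B b) * (\<Prod>i\<in>{1..n}. ?y i ^ b i) =
      fps_const (fps_X ^ (\<Sum>i=1..n. i * b i)) * fps_lift (?f b)" for b
    by (simp add: power_mult_distrib prod.distrib fps_lift_mult fps_lift_power fps_lift_prod
        power_sum power_mult fps_const_power const_prod mult_ac)
  have "(family_fps f n ^ q) $ m $ n / fact q = (?h (1 / fact q) * family_fps f n ^ q) $ m $ n"
    by simp
  also have "?h (1 / fact q) * family_fps f n ^ q =
      (\<Sum>b\<in>?P. ?h (?c b) * (fps_lift (f 0) ^ (q - ?B b) * (\<Prod>i\<in>{1..n}. ?y i ^ b i)))"
    unfolding family_fps_def by (rule multinomial_expansion) simp_all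
  also have "\<dots> $ m $ n = (\<Sum>b\<in>?P. if (\<Sum>i=1..n. i * b i) = n then ?f b $ m * ?c b else 0)"
    unfolding monomial fps_sum_nth
    by (intro sum.cong refl) (auto simp: fps_X_power_mult_nth)
  also have "\<dots> = (\<Sum>b\<in>{b\<in>?P. (\<Sum>i=1..n. i * b i) = n}. ?f b $ m * ?c b)"
    by (rule sum.inter_filter[symmetric], rule finite_PiE_sum_le) simp
  also have "{b\<in>?P. (\<Sum>i=1..n. i * b i) = n} =
    {b. (b \<in> {1..n} \<rightarrow>\<^sub>E UNIV \<and> (\<Sum>i=1..n. i * b i) = n) \<and> ?B b \<le> q}"
    by auto
  finally show ?thesis by simp
qed

lemma one_plus_X_mult_power_nth:
  fixes F :: "'r::comm_ring_1 fps"
  shows "((1 + fps_X * F) ^ Suc k) $ k = (\<Sum>m\<le>k. of_nat (Suc k choose Suc m) * (F ^ (k - m)) $ m)"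
proof -
  have "((1 + fps_X * F) ^ Suc k) $ k = (\<Sum>q\<le>Suc k. of_nat (Suc k choose q) * (fps_X ^ q * F ^ q) $ k)"
    by (subst add.commute, subst binomial_ring)
       (simp add: fps_sum_nth power_mult_distrib mult.assoc flip: fps_of_nat del: power_Suc)
  also have "\<dots> = (\<Sum>q\<le>k. of_nat (Suc k choose q) * (F ^ q) $ (k - q))"
    by (auto simp: fps_X_power_mult_nth simp del: power_Suc binomial_Suc_Suc intro!: sum.cong)
  also have "\<dots> = (\<Sum>m\<le>k. of_nat (Suc k choose Suc m) * (F ^ (k - m)) $ m)"
    by (rule sum.reindex_bij_witness[of _ "\<lambda>m. k - m" "\<lambda>m. k - m"])
       (auto simp: binomial_symmetric[of "Suc _" "Suc k"] Suc_diff_le simp del: binomial_Suc_Suc)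
  finally show ?thesis .
qed

text \<open>
  The derivatives in \<open>mu\<close> are \<open>m!\<close> times Taylor coefficients of products, so for fixed \<open>m\<close> the sum over
  \<open>b\<close> is the coefficient of \<open>t\<^sup>n x\<^sup>m\<close> in \<open>F\<^sup>k\<^sup>-\<^sup>m / (k - m)!\<close>, where \<open>F\<close> is the generating function of the
  Taylor series. The factor in front turns into the binomial coefficient of \<open>(1 + x F)\<^sup>k\<^sup>+\<^sup>1\<close>, because
  \<open>(k + 1) k! / ((m + 1)! (k - m)!)\<close> is \<open>k + 1\<close> over \<open>m + 1\<close>.
\<close>

lemma mu_eq_coefficient:
  fixes \<Psi> :: "nat \<Rightarrow> 'a::real_normed_field \<Rightarrow> 'a"
  assumes "\<And>i. i \<le> n \<Longrightarrow> infinitely_differentiable_at (\<Psi> i) 0"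
  defines "f \<equiv> \<lambda>i. taylor (deriv (\<Psi> i))"
  shows "of_nat (k + 1) * mu \<Psi> n k = ((1 + fps_X * family_fps f n) ^ (k + 1)) $ k $ n"
proof -
  let ?B = "\<lambda>b. \<Sum>i=1..n. b i"
  let ?Q = "{b. b \<in> {1..n} \<rightarrow>\<^sub>E (UNIV :: nat set) \<and> (\<Sum>i=1..n. i * b i) = n}"
  let ?F = "family_fps f n"
  let ?t = "\<lambda>b m. (f 0 ^ (k - m - ?B b) * (\<Prod>i=1..n. f i ^ b i)) $ m
    / (fact (k - m - ?B b) * (\<Prod>i=1..n. fact (b i)))"
  have smooth: "infinitely_differentiable_at (deriv (\<Psi> i)) 0" if "i \<le> n" for i
    using infinitely_differentiable_at_iterate[OF assms(1)[OF that], of 1] by simp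
  have derivative: "(deriv ^^ m) (\<lambda>x. deriv (\<Psi> 0) x ^ q * (\<Prod>i=1..n. deriv (\<Psi> i) x ^ b i)) 0
      = fact m * (f 0 ^ q * (\<Prod>i=1..n. f i ^ b i)) $ m" for m q b
  proof -
    have "infinitely_differentiable_at (\<lambda>x. \<Prod>i=1..n. deriv (\<Psi> i) x ^ b i) 0 \<and>
        taylor (\<lambda>x. \<Prod>i=1..n. deriv (\<Psi> i) x ^ b i) = (\<Prod>i=1..n. taylor (\<lambda>x. deriv (\<Psi> i) x ^ b i))"
      by (rule taylor_prod) (simp_all add: smooth taylor_power)
    then have "taylor (\<lambda>x. deriv (\<Psi> 0) x ^ q * (\<Prod>i=1..n. deriv (\<Psi> i) x ^ b i)) =
        f 0 ^ q * (\<Prod>i=1..n. f i ^ b i)"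
      by (simp add: taylor_mult taylor_power smooth f_def)
    from this[symmetric] show ?thesis by (simp add: taylor_def)
  qed
  have finQ: "finite ?Q"
  proof (rule finite_subset)
    show "finite ({1..n} \<rightarrow>\<^sub>E {..n})" by (simp add: finite_PiE)
    have bound: "b i \<le> n" if "(\<Sum>i=1..n. i * b i) = n" "i \<in> {1..n}" for b i
    proof -
      have "b i \<le> i * b i" using that(2) by simp
      also have "\<dots> \<le> n" using member_le_sum[of i "{1..n}" "\<lambda>i. i * b i"] that by simp
      finally show ?thesis .
    qed
    show "?Q \<subseteq> {1..n} \<rightarrow>\<^sub>E {..n}"
    proof
      fix b assume "b \<in> ?Q"
      then have "b \<in> extensional {1..n}" "(\<Sum>i=1..n. i * b i) = n" by (simp_all add: PiE_iff)
      with bound show "b \<in> {1..n} \<rightarrow>\<^sub>E {..n}" unfolding PiE_iff by blast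
    qed
  qed
  have cancel: "a * (b / (c * d * r * p) * (c * y)) = a * b / d * (y / (r * p))"
    if "c \<noteq> 0" for a b c d r p y :: 'a
    using that by simp
  have fact_rec: "of_nat (k + 1) * fact k = (fact (k + 1) :: 'a)" by simp
  have "of_nat (k + 1) * mu \<Psi> n k =
      (\<Sum>b\<in>?Q. \<Sum>m | m + ?B b \<le> k. fact (k + 1) / fact (m + 1) * ?t b m)"
    unfolding mu_def derivative sum_distrib_left cancel[OF fact_nonzero] fact_rec ..
  also have "\<dots> = (\<Sum>b\<in>?Q. \<Sum>m | m \<in> {..k} \<and> ?B b \<le> k - m. fact (k + 1) / fact (m + 1) * ?t b m)"
    by (intro sum.cong refl) auto
  also have "\<dots> = (\<Sum>m\<in>{..k}. \<Sum>b | b \<in> ?Q \<and> ?B b \<le> k - m. fact (k + 1) / fact (m + 1) * ?t b m)"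
    by (rule sum.swap_restrict[OF finQ]) simp
  also have "\<dots> = (\<Sum>m\<le>k. fact (k + 1) / fact (m + 1) * ((?F ^ (k - m)) $ m $ n / fact (k - m)))"
    unfolding family_fps_power_nth_nth sum_distrib_left mem_Collect_eq ..
  also have "\<dots> = (\<Sum>m\<le>k. of_nat (Suc k choose Suc m) * (?F ^ (k - m)) $ m $ n)"
    by (intro sum.cong refl, subst binomial_fact) (simp_all del: fact_Suc)
  also have "\<dots> = ((1 + fps_X * ?F) ^ (k + 1)) $ k $ n"
    unfolding Suc_eq_plus1[symmetric] one_plus_X_mult_power_nth
    by (simp add: fps_sum_nth flip: fps_of_nat)
  finally show ?thesis .
qed

theorem theorem18:
  fixes \<Psi> :: "nat \<Rightarrow> 'a::real_normed_field \<Rightarrow> 'a" and n k :: nat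
  assumes "n \<ge> 1"
    and "\<And>i. i \<le> n \<Longrightarrow> infinitely_differentiable_at (\<Psi> i) 0"
    and "k \<ge> 1"
  shows "mu \<Psi> n k =
    (\<Sum>\<pi>\<in>NC k. \<Sum>l | l \<in> \<pi> \<rightarrow>\<^sub>E (UNIV :: nat set) \<and> (\<Sum>V\<in>\<pi>. l V) = n.
       1 / (\<Prod>V\<in>\<pi>. fact (l V)) * (\<Prod>V\<in>\<pi>. c_coeff \<Psi> (l V) (card V)))"
proof -
  define f where "f = (\<lambda>i. taylor (deriv (\<Psi> i)))"
  define \<phi> where "\<phi> = 1 + fps_X * family_fps f n"
  let ?S = "\<Sum>\<pi>\<in>NC k. \<Prod>V\<in>\<pi>. \<phi> $ card V"
  have "of_nat (k + 1) * mu \<Psi> n k = (\<phi> ^ (k + 1)) $ k $ n"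
    unfolding \<phi>_def f_def by (rule mu_eq_coefficient) (rule assms(2))
  also have "(\<phi> ^ (k + 1)) $ k = of_nat (k + 1) * ?S"
    by (rule sum_NC_eq_coefficient[symmetric]) (simp add: \<phi>_def)
  also have "\<dots> $ n = of_nat (k + 1) * ?S $ n"
    by (simp only: fps_mult_left_const_nth flip: fps_of_nat)
  finally have "mu \<Psi> n k = ?S $ n"
    by (metis add_is_0 mult_left_cancel of_nat_eq_0_iff one_neq_zero)
  also have "\<dots> = (\<Sum>\<pi>\<in>NC k. (\<Prod>V\<in>\<pi>. \<phi> $ card V) $ n)"
    by (simp add: fps_sum_nth)
  also have "\<dots> = (\<Sum>\<pi>\<in>NC k. \<Sum>l | l \<in> \<pi> \<rightarrow>\<^sub>E (UNIV :: nat set) \<and> (\<Sum>V\<in>\<pi>. l V) = n.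
       1 / (\<Prod>V\<in>\<pi>. fact (l V)) * (\<Prod>V\<in>\<pi>. c_coeff \<Psi> (l V) (card V)))"
  proof (rule sum.cong[OF refl])
    fix \<pi> assume "\<pi> \<in> NC k"
    then have part: "partition_on {1..k} \<pi>" by (simp add: NC_def)
    then have fin: "finite \<pi>" by (rule finite_elements[rotated]) simp
    have "\<phi> $ card V $ i = c_coeff \<Psi> i (card V) / fact i" if "V \<in> \<pi>" "i \<le> n" for V i
    proof -
      have "V \<subseteq> {1..k}" "V \<noteq> {}" using part that(1) by (auto simp: partition_on_def)
      then have "card V \<noteq> 0" using finite_subset by fastforce
      then obtain s where "card V = Suc s" using not0_implies_Suc by blast
      then show ?thesis
        using that(2) by (simp add: \<phi>_def family_fps_nth_nth f_def taylor_def c_coeff_def funpow_swap1)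
    qed
    moreover have "l V \<le> n" if "(\<Sum>V\<in>\<pi>. l V) = n" "V \<in> \<pi>" for l V
      using member_le_sum[of V \<pi> l] that fin by simp
    ultimately show "(\<Prod>V\<in>\<pi>. \<phi> $ card V) $ n =
      (\<Sum>l | l \<in> \<pi> \<rightarrow>\<^sub>E UNIV \<and> (\<Sum>V\<in>\<pi>. l V) = n.
         1 / (\<Prod>V\<in>\<pi>. fact (l V)) * (\<Prod>V\<in>\<pi>. c_coeff \<Psi> (l V) (card V)))"
      unfolding fps_prod_nth_PiE[OF fin]
      by (intro sum.cong refl) (simp flip: prod_dividef)
  qed
  finally show ?thesis .
qed

end
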